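(* For any $a\in[0,1]$ there exists a function $h:\mathbb{R}^2\to\{a,a-1\}$ such that, with $T_h:\mathbb{R}^2\to\mathbb{R}^2$ defined by $T_h(x,y)=(x+y,\,y+h(x,y))$, the set $\{T_h^n(0,0): n\ge1\}\subset\mathbb{R}^2$ is bounded.
   Context: $T_h^n$ denotes the $n$-fold iterate of $T_h$. *)

theory Defs
  imports "HOL-Analysis.Analysis"
begin

definition T :: "(real \<times> real \<Rightarrow> real) \<Rightarrow> real \<times> real \<Rightarrow> real \<times> real" where
  "T h = (\<lambda>(x, y). (x + y, y + h (x, y)))"

end

theory Submission
  imports Defs
begin

text \<open>
  For \<open>0 < a < 1\<close> use a feedback that keeps \<open>y\<close> in \<open>[-1, 1]\<close> and steers \<open>y\<close> against the sign
  of \<open>x\<close>: while \<open>x \<ge> 0\<close>, \<open>y\<close> drops by \<open>1 - a\<close> per step until it is negative and then stays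
  negative, and symmetrically while \<open>x < 0\<close>. Hence \<open>x\<close> can overshoot only during a bounded number
  of steps; quantitatively, \<open>x + max 0 y / (1 - a)\<close> stays bounded above and
  \<open>x - max 0 (-y) / a\<close> stays bounded below.
\<close>

definition feedback :: "real \<Rightarrow> real \<times> real \<Rightarrow> real" where
  "feedback a = (\<lambda>(x, y).
     if x < 0 then (if y < 1 - a then a else a - 1)
     else (if y < - a then a else a - 1))"

text \<open>The bounds on \<open>x\<close> are multiplied by \<open>1 - a\<close> and \<open>a\<close>, with each maximum split into two
  inequalities.\<close>

definition trap :: "real \<Rightarrow> (real \<times> real) set" where
  "trap a = {(x, y). \<bar>y\<bar> \<le> 1 \<and>
     (1 - a) * x \<le> 2 - a \<and> (1 - a) * x + y \<le> 2 - a \<and>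
     - (1 + a) \<le> a * x \<and> - (1 + a) \<le> a * x + y}"

lemma T_feedback_trap:
  assumes a: "0 < a" "a < 1" and p: "p \<in> trap a"
  shows "T (feedback a) p \<in> trap a"
proof -
  obtain x y where [simp]: "p = (x, y)" by (cases p)
  have y: "-1 \<le> y" "y \<le> 1"
    and x: "x - a * x \<le> 2 - a" "x - a * x + y \<le> 2 - a" "- (1 + a) \<le> a * x" "- (1 + a) \<le> a * x + y"
    using p by (auto simp: trap_def algebra_simps)
  \<comment> \<open>These sign facts for products make the rest linear, with \<open>a * x\<close>
    and \<open>a * y\<close> as atoms.\<close>
  have ay: "- a \<le> a * y" "a * y \<le> a" "0 \<le> y + 1 - (a * y + a)" "0 \<le> 1 - y - (a - a * y)"
    using a y mult_nonneg_nonneg[of a "1 + y"] mult_nonneg_nonneg[of a "1 - y"]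
      mult_nonneg_nonneg[of "1 - a" "1 + y"] mult_nonneg_nonneg[of "1 - a" "1 - y"]
    by (simp_all add: algebra_simps)
  have pos: "0 \<le> a * z \<and> a * z \<le> z" if "0 \<le> z" for z
    using a that by (simp add: mult_left_le_one_le)
  have neg: "z \<le> a * z \<and> a * z \<le> 0" if "z \<le> 0" for z
    using pos[of "- z"] that by simp
  consider "0 \<le> y" "0 \<le> a * y" "a * y \<le> y" | "y < 0" "y \<le> a * y" "a * y \<le> 0"
    using pos[of y] neg[of y] by linarith
  note y_cases = this
  consider "0 \<le> x" "0 \<le> a * x" "a * x \<le> x" | "x < 0" "x \<le> a * x" "a * x \<le> 0"
    using pos[of x] neg[of x] by linarith
  note x_cases = this
  define u where "u = feedback a p"
  have "u = (if x < 0 then if y < 1 - a then a else a - 1 else if y < - a then a else a - 1)"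
    by (simp add: u_def feedback_def)
  then consider "x < 0" "y < 1 - a" "u = a" | "x < 0" "1 - a \<le> y" "u = a - 1"
    | "0 \<le> x" "y < - a" "u = a" | "0 \<le> x" "- a \<le> y" "u = a - 1"
    by (cases "x < 0"; cases "y < 1 - a"; cases "y < - a") simp_all
  note u_cases = this
  \<comment> \<open>In every case \<open>u = a\<close> forces \<open>y < 1 - a\<close>, and
    \<open>u = a - 1\<close> forces \<open>- a \<le> y\<close>.\<close>
  have "-1 \<le> y + u" "y + u \<le> 1"
    using a y by (cases rule: u_cases; linarith)+
  \<comment> \<open>From \<open>x < 0\<close> the new x is below 1 and the new y at most 1, whence
    the constant \<open>(1 - a) + 1\<close>. From \<open>x \<ge> 0\<close> and
    \<open>y \<ge> 0\<close>, the gain \<open>(1 - a) * y\<close> is at most the drop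
    \<open>1 - a\<close> of y.\<close>
  moreover have "x + y - (a * x + a * y) \<le> 2 - a"
    using a y x ay by (cases rule: u_cases; cases rule: x_cases; cases rule: y_cases; linarith)
  moreover have "x + y - (a * x + a * y) + (y + u) \<le> 2 - a"
    using a y x ay by (cases rule: u_cases; cases rule: x_cases; cases rule: y_cases; linarith)
  moreover have "- (1 + a) \<le> a * x + a * y"
    using a y x ay by (cases rule: u_cases; cases rule: x_cases; cases rule: y_cases; linarith)
  moreover have "- (1 + a) \<le> a * x + a * y + (y + u)"
    using a y x ay by (cases rule: u_cases; cases rule: x_cases; cases rule: y_cases; linarith)
  ultimately show ?thesis
    by (simp add: T_def trap_def u_def abs_le_iff algebra_simps)
qed

lemma bounded_trap:
  assumes "0 < a" "a < 1"
  shows "bounded (trap a)"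
proof (rule bounded_subset)
  show "bounded ({- (1 + a) / a .. (2 - a) / (1 - a)} \<times> {-1..1::real})"
    by (intro bounded_Times bounded_closed_interval)
  show "trap a \<subseteq> {- (1 + a) / a .. (2 - a) / (1 - a)} \<times> {-1..1}"
    using assms by (auto simp: trap_def pos_divide_le_eq pos_le_divide_eq mult.commute)
qed

theorem theorem3p1:
  fixes a :: real
  assumes "a \<in> {0..1}"
  shows "\<exists>h :: real \<times> real \<Rightarrow> real.
           range h \<subseteq> {a, a - 1} \<and> bounded {(T h ^^ n) (0, 0) | n. n \<ge> 1}"
proof (cases "a = 0 \<or> a = 1")
  case True
  \<comment> \<open>At the endpoints 0 is an allowed value, so the origin can be fixed; there
    \<open>trap a\<close> would lose a bound on x.\<close>
  have "(T (\<lambda>_. 0) ^^ n) (0, 0) = (0, 0)" for n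
    by (induction n) (auto simp: T_def)
  then have "bounded {(T (\<lambda>_. 0) ^^ n) (0, 0) | n. n \<ge> 1}"
    by (auto intro: bounded_subset[of "{(0, 0)}"])
  with True show ?thesis by (intro exI[of _ "\<lambda>_. 0"]) auto
next
  case False
  with assms have a: "0 < a" "a < 1" by auto
  have "(T (feedback a) ^^ n) (0, 0) \<in> trap a" for n
  proof (induction n)
    case 0
    show ?case using a by (simp add: trap_def)
  next
    case (Suc n)
    then show ?case using a by (simp add: T_feedback_trap)
  qed
  then have "bounded {(T (feedback a) ^^ n) (0, 0) | n. n \<ge> 1}"
    by (intro bounded_subset[OF bounded_trap[OF a]]) auto
  moreover have "feedback a p \<in> {a, a - 1}" for p
    by (cases p) (simp add: feedback_def)
  ultimately show ?thesis by (intro exI[of _ "feedback a"]) blast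
qed

end
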